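(* Let $a\in(0,1)$, $b=1-a$, and let $X_0,X_1,X_2,\dots$ be i.i.d. flips of a biased coin with $\mathbb{P}(X_i=H)=a$ and $\mathbb{P}(X_i=T)=b$. Let $p$ be a prime, and let $\mathcal{A}_2(p)$ be the algorithm, driven by this sequence of flips, described in the context. Then: (i) $\mathcal{A}_2(p)$ terminates after a finite number of flips with probability $1$, and its return value is uniformly distributed on $\{0,\dots,p-1\}$: $$\mathbb{P}(\mathcal{A}_2(p)=m)=\frac1p,\qquad \forall\,0\le m\le p-1.$$ (ii) The expected number of flips used by $\mathcal{A}_2(p)$ until termination is $$\frac{p}{1-a^p-b^p};$$ in particular, for fixed $a$, this is $O(p)$ as $p\to\infty$ through the primes. (iii) For $p=2$, $\mathcal{A}_2(2)$ is exactly Von Neumann's algorithm $\mathcal{A}_1$ described in the context, i.e. on every sequence of flips the two algorithms use the same flips and return the same value.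
   Context: For a finite sequence of flips $\boldsymbol{x}=(x_0,\dots,x_{n-1})\in\{H,T\}^n$, the rank sum of heads is $S_{\mathrm{head}}(\boldsymbol{x})=\sum_{i=0}^{n-1} i\cdot 1_{\{x_i=H\}}$ (ranks run from $0$ to $n-1$). Algorithm $\mathcal{A}_2(p)$ ($p$ prime; input: a sequence of coin flips; output: an integer in $\{0,\dots,p-1\}$): 1. Flip the coin $p$ times (taking the next $p$ unused flips of the sequence), and denote the outcome by $\boldsymbol{X}^p\in\{H,T\}^p$, indexed from $0$ to $p-1$. 2. If the outcome is all heads or all tails, discard it and return to step 1. 3. Otherwise return $S_{\mathrm{head}}(\boldsymbol{X}^p)\bmod p$. Algorithm $\mathcal{A}_1$ (Von Neumann; input: a sequence of coin flips; output: $0$ or $1$): 1. Flip the coin twice (taking the next two unused flips). 2. If the result is $HH$ or $TT$, discard the two flips and return to step 1. 3. If the result is $HT$, return $0$; if the result is $TH$, return $1$. *)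

theory Defs
  imports "HOL-Probability.Probability" "HOL-Library.Landau_Symbols"
begin

datatype coin = Heads | Tails

definition S_head :: "coin list \<Rightarrow> nat" where
  "S_head xs = (\<Sum>i<length xs. i * of_bool (xs ! i = Heads))"

text \<open>
  A run of an algorithm on an infinite sequence of flips either never terminates, represented by
  \<^term>\<open>None\<close>, or yields \<^term>\<open>Some (r, n)\<close>, where \<open>r\<close> is the return value and \<open>n\<close> the number of
  flips used.  Flips are consumed in order, so the flips used are exactly those with index below
  \<open>n\<close>.  In the recursive functions below, \<open>k\<close> is the index of the next unused flip; it is carried
  along and returned as the number of flips used, the run starting with \<open>k = 0\<close>.
\<close>

partial_function (option) A2_from :: "nat \<Rightarrow> (nat \<Rightarrow> coin) \<Rightarrow> nat \<Rightarrow> (nat \<times> nat) option" where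
  "A2_from p x k =
     (let xs = map x [k..<k + p] in
      if (\<forall>c\<in>set xs. c = Heads) \<or> (\<forall>c\<in>set xs. c = Tails) then A2_from p x (k + p)
      else Some (S_head xs mod p, k + p))"

definition A2 :: "nat \<Rightarrow> (nat \<Rightarrow> coin) \<Rightarrow> (nat \<times> nat) option" where
  "A2 p x = A2_from p x 0"

partial_function (option) A1_from :: "(nat \<Rightarrow> coin) \<Rightarrow> nat \<Rightarrow> (nat \<times> nat) option" where
  "A1_from x k =
     (case (x k, x (k + 1)) of
        (Heads, Heads) \<Rightarrow> A1_from x (k + 2)
      | (Tails, Tails) \<Rightarrow> A1_from x (k + 2)
      | (Heads, Tails) \<Rightarrow> Some (0, k + 2)
      | (Tails, Heads) \<Rightarrow> Some (1, k + 2))"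

definition A1 :: "(nat \<Rightarrow> coin) \<Rightarrow> (nat \<times> nat) option" where
  "A1 x = A1_from x 0"

definition terminates :: "(nat \<times> nat) option \<Rightarrow> bool" where
  "terminates run \<longleftrightarrow> run \<noteq> None"

definition return_value :: "(nat \<times> nat) option \<Rightarrow> nat option" where
  "return_value run = map_option fst run"

definition flips_used :: "(nat \<times> nat) option \<Rightarrow> ennreal" where
  "flips_used run = (case run of None \<Rightarrow> \<infinity> | Some (r, n) \<Rightarrow> of_nat n)"

end

theory Submission
  imports Defs "HOL-Number_Theory.Cong"
begin

text \<open>
  Cut the flips into consecutive blocks of length \<open>p\<close>.  The algorithm returns at the first block
  that is mixed, that is, contains both faces.  Two facts carry everything.

  \<^emph>\<open>Uniformity.\<close>  All rotations of a block have the same probability and are mixed together.  A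
  rotation by one place lowers the rank sum by the number \<open>h\<close> of heads, modulo \<open>p\<close>: every head
  loses one rank, and a head moved from rank \<open>0\<close> to rank \<open>p - 1\<close> agrees with this modulo \<open>p\<close>.
  For a mixed block \<open>0 < h < p\<close>, so \<open>h\<close> is invertible modulo the prime \<open>p\<close>, and among its \<open>p\<close>
  rotations every residue occurs exactly once (\<open>ex1_rotation\<close>).  Averaging over rotations shows
  that each residue receives the fraction \<open>1 / p\<close> of the probability of a mixed block
  (\<open>sum_weight_residue\<close>).

  \<^emph>\<open>Independence of blocks.\<close>  A block is constant with probability \<open>q = a\<^sup>p + b\<^sup>p\<close>, so the run
  is still going after \<open>j\<close> blocks with probability \<open>q\<^sup>j\<close> (\<open>prob_waiting\<close>), and the next block
  is independent of that event (\<open>prob_waiting_block\<close>).  Hence the value \<open>m\<close> is returned with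
  probability \<open>(\<Sum>j. q\<^sup>j * (1 - q) / p) = 1 / p\<close>.  The number of flips used is \<open>p\<close> times the
  number of \<open>j\<close> for which the run is still going after \<open>j\<close> blocks, with value \<open>\<infinity>\<close> for a run
  that never stops; its expectation is therefore \<open>(\<Sum>j. p * q\<^sup>j) = p / (1 - q)\<close>.  This is
  finite, so almost every run terminates.  For \<open>p \<ge> 2\<close> the denominator is at least
  \<open>1 - a\<^sup>2 - b\<^sup>2 = 2 * a * b\<close>, which gives the linear bound.

  For \<open>p = 2\<close> the mixed blocks are HT and TH, with rank sums \<open>0\<close> and \<open>1\<close>, so both
  algorithms satisfy the same recursion.
\<close>

section \<open>Blocks and rank sums\<close>

definition constant_block :: "coin list \<Rightarrow> bool" where
  "constant_block xs \<longleftrightarrow> (\<forall>c\<in>set xs. c = Heads) \<or> (\<forall>c\<in>set xs. c = Tails)"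

definition block :: "nat \<Rightarrow> (nat \<Rightarrow> coin) \<Rightarrow> nat \<Rightarrow> coin list" where
  "block p x j = map x [j * p..<j * p + p]"

definition mixed_lists :: "nat \<Rightarrow> coin list set" where
  "mixed_lists p = {xs. length xs = p \<and> \<not> constant_block xs}"

definition flip_weight :: "real \<Rightarrow> coin list \<Rightarrow> real" where
  "flip_weight a xs = (\<Prod>c\<leftarrow>xs. if c = Heads then a else 1 - a)"

definition heads :: "coin list \<Rightarrow> nat" where
  "heads xs = length (filter (\<lambda>c. c = Heads) xs)"

lemma length_block [simp]: "length (block p x j) = p"
  by (simp add: block_def)

lemma finite_coin_lists: "finite {xs :: coin list. length xs = n}"
proof -
  have "(UNIV :: coin set) = {Heads, Tails}"
    using coin.exhaust by auto
  then have "finite (UNIV :: coin set)"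
    by (metis finite.emptyI finite.insertI)
  from finite_lists_length_eq[OF this, of n] show ?thesis by simp
qed

lemma finite_mixed_lists: "finite (mixed_lists p)"
  by (rule finite_subset[OF _ finite_coin_lists[of p]]) (auto simp: mixed_lists_def)

section \<open>Runs in terms of the first mixed block\<close>

lemma A2_from_block:
  "A2_from p x (j * p) =
     (if constant_block (block p x j) then A2_from p x (Suc j * p)
      else Some (S_head (block p x j) mod p, Suc j * p))"
  by (subst A2_from.simps) (simp add: constant_block_def block_def Let_def add.commute)

text \<open>A terminating run is followed backwards from its last block \<open>j\<close> to an earlier block \<open>i\<close>.\<close>
lemma A2_from_first_mixed:
  assumes "i \<le> j" "\<forall>l. i \<le> l \<and> l < j \<longrightarrow> constant_block (block p x l)"
    and "\<not> constant_block (block p x j)"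
  shows "A2_from p x (i * p) = Some (S_head (block p x j) mod p, Suc j * p)"
  using assms
proof (induction i rule: inc_induct)
  case base
  then show ?case by (subst A2_from_block) simp
next
  case (step n)
  then show ?case by (subst A2_from_block) simp
qed

lemma A2_eq_SomeI:
  assumes "\<forall>l<j. constant_block (block p x l)" and "\<not> constant_block (block p x j)"
  shows "A2 p x = Some (S_head (block p x j) mod p, Suc j * p)"
  using A2_from_first_mixed[of 0 j p x] assms by (simp add: A2_def)

text \<open>
  On a constant sequence, unfolding the recursion only leads from one block to the next and never
  excludes a result.  Divergence follows from leastness of the fixed point, in the form of the
  following rules: every terminating run has a finite derivation.  They are the generated rules
  with the tupled arguments separated.
\<close>
lemmas A2_from_induct =
  A2_from.raw_induct[where xa = "((p, x), k)" for p x k, unfolded prod.case]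

lemmas A1_from_induct =
  A1_from.raw_induct[where xa = "(x, k)" for x k, unfolded prod.case]

lemma A2_from_Some_imp_mixed:
  assumes "A2_from p x k = Some y"
  shows "\<forall>i. k = i * p \<longrightarrow> (\<exists>j. \<not> constant_block (block p x j))"
proof (rule A2_from_induct[OF _ assms, where P = "\<lambda>p x k y.
    \<forall>i. k = i * p \<longrightarrow> (\<exists>j. \<not> constant_block (block p x j))"], intro allI impI)
  fix f p x k y i
  assume IH: "\<And>p x k y. f p x k = Some y \<Longrightarrow>
      \<forall>i. k = i * p \<longrightarrow> (\<exists>j. \<not> constant_block (block p x j))"
    and run: "(let xs = map x [k..<k + p] in
      if (\<forall>c\<in>set xs. c = Heads) \<or> (\<forall>c\<in>set xs. c = Tails) then f p x (k + p)
      else Some (S_head xs mod p, k + p)) = Some y"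
    and k: "k = i * p"
  show "\<exists>j. \<not> constant_block (block p x j)"
  proof (cases "constant_block (block p x i)")
    case True
    then have "f p x (Suc i * p) = Some y"
      using run k by (simp add: constant_block_def block_def Let_def add.commute)
    then show ?thesis using IH by blast
  qed auto
qed

lemma A2_eq_None_iff: "A2 p x = None \<longleftrightarrow> (\<forall>j. constant_block (block p x j))"
proof
  assume *: "A2 p x = None"
  show "\<forall>j. constant_block (block p x j)"
  proof (rule ccontr)
    assume "\<not> ?thesis"
    then obtain j where "\<not> constant_block (block p x j)"
      "\<forall>l<j. constant_block (block p x l)"
      using exists_least_iff[of "\<lambda>j. \<not> constant_block (block p x j)"] by blast
    with A2_eq_SomeI[of j p x] * show False by simp
  qed
next
  assume "\<forall>j. constant_block (block p x j)"
  then show "A2 p x = None"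
    using A2_from_Some_imp_mixed[of p x 0] by (cases "A2 p x") (auto simp: A2_def)
qed

lemma A2_eq_Some_iff:
  "A2 p x = Some (r, n) \<longleftrightarrow>
     (\<exists>j. n = Suc j * p \<and> (\<forall>l<j. constant_block (block p x l)) \<and>
          \<not> constant_block (block p x j) \<and> S_head (block p x j) mod p = r)"
proof
  assume *: "A2 p x = Some (r, n)"
  then have "\<not> (\<forall>j. constant_block (block p x j))"
    using A2_eq_None_iff[of p x] by simp
  then obtain j where "\<not> constant_block (block p x j)"
      "\<forall>l<j. constant_block (block p x l)"
    using exists_least_iff[of "\<lambda>j. \<not> constant_block (block p x j)"] by blast
  with A2_eq_SomeI[of j p x] * show "\<exists>j. n = Suc j * p \<and> (\<forall>l<j. constant_block (block p x l)) \<and>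
          \<not> constant_block (block p x j) \<and> S_head (block p x j) mod p = r"
    by auto
next
  assume "\<exists>j. n = Suc j * p \<and> (\<forall>l<j. constant_block (block p x l)) \<and>
          \<not> constant_block (block p x j) \<and> S_head (block p x j) mod p = r"
  then show "A2 p x = Some (r, n)"
    using A2_eq_SomeI[of _ p x] by auto
qed

text \<open>
  Block \<open>j\<close> is read exactly when the blocks before it are constant, and reading it costs \<open>p\<close>
  flips.  Writing the cost as a series of indicators covers terminating and non-terminating runs
  at once, and lets the expectation be taken term by term.
\<close>
lemma flips_used_A2:
  assumes "0 < p"
  shows "flips_used (A2 p x) =
    (\<Sum>j. ennreal (real p) * indicator {j. \<forall>l<j. constant_block (block p x l)} j)"
proof (cases "\<forall>j. constant_block (block p x j)")
  case True
  have "\<not> summable (\<lambda>_::nat. real p)"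
    using assms by (simp add: summable_const_iff)
  then have "(\<Sum>j. ennreal (real p)) = \<infinity>"
    unfolding infinity_ennreal_def by (intro summable_iff_suminf_neq_top) auto
  moreover have "A2 p x = None"
    using True by (simp add: A2_eq_None_iff)
  ultimately show ?thesis
    using True by (simp add: flips_used_def indicator_def)
next
  case False
  then obtain N where N: "\<not> constant_block (block p x N)"
      "\<forall>l<N. constant_block (block p x l)"
    using exists_least_iff[of "\<lambda>j. \<not> constant_block (block p x j)"] by blast
  have set_eq: "{j. \<forall>l<j. constant_block (block p x l)} = {..N}"
    using N by (auto intro: leI dest: less_le_trans)
  have "(\<Sum>j. ennreal (real p) * indicator {..N} j) = (\<Sum>j\<le>N. ennreal (real p) * indicator {..N} j)"
    by (rule suminf_finite) auto
  also have "\<dots> = (\<Sum>j\<le>N. ennreal (real p))"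
    by (rule sum.cong) auto
  also have "\<dots> = of_nat (Suc N * p)"
    by (simp add: ennreal_of_nat_eq_real_of_nat algebra_simps flip: ennreal_mult')
  finally show ?thesis
    using A2_eq_SomeI[OF N(2) N(1)] by (simp add: flips_used_def set_eq)
qed

section \<open>Rotations and uniformity\<close>

lemma S_head_Nil [simp]: "S_head [] = 0"
  by (simp add: S_head_def)

lemma S_head_snoc: "S_head (xs @ [c]) = S_head xs + length xs * of_bool (c = Heads)"
  by (simp add: S_head_def nth_append)

lemma S_head_Cons: "S_head (c # xs) = S_head xs + heads xs"
  by (induction xs rule: rev_induct)
     (simp_all add: S_head_snoc heads_def S_head_def[of "[_]"] flip: append_Cons)

text \<open>
  All ranks drop by one, except that a head in front moves from rank \<open>0\<close> to the last rank, which
  is congruent to \<open>-1\<close>.  Adding the number of heads on the left avoids subtraction on \<^typ>\<open>nat\<close>.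
\<close>
lemma S_head_rotate1: "[S_head (rotate1 xs) + heads xs = S_head xs] (mod length xs)"
proof (cases xs)
  case (Cons c ys)
  have "S_head (rotate1 xs) + heads xs = S_head xs + length xs * of_bool (c = Heads)"
    by (simp add: Cons S_head_snoc S_head_Cons) (simp add: heads_def)
  then show ?thesis by (simp add: cong_def)
qed (simp add: heads_def)

lemma heads_rotate [simp]: "heads (rotate s xs) = heads xs"
proof -
  have "heads (rotate1 ys) = heads ys" for ys
    by (cases ys) (simp_all add: heads_def)
  then show ?thesis by (induction s) simp_all
qed

lemma S_head_rotate: "[S_head (rotate s xs) + s * heads xs = S_head xs] (mod length xs)"
proof (induction s)
  case (Suc s)
  have "[S_head (rotate1 (rotate s xs)) + heads xs = S_head (rotate s xs)] (mod length xs)"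
    using S_head_rotate1[of "rotate s xs"] by simp
  then have "[S_head (rotate1 (rotate s xs)) + heads xs + s * heads xs
      = S_head (rotate s xs) + s * heads xs] (mod length xs)"
    by (rule cong_add) simp
  with Suc show ?case by (auto simp: algebra_simps intro: cong_trans)
qed simp

lemma heads_mixed:
  assumes "xs \<in> mixed_lists p"
  shows "0 < heads xs" "heads xs < p"
proof -
  have *: "length xs = p" "Heads \<in> set xs" "\<exists>c\<in>set xs. c \<noteq> Heads"
    using assms coin.exhaust by (auto simp: mixed_lists_def constant_block_def)
  show "0 < heads xs"
    using *(2) by (simp add: heads_def filter_empty_conv)
  show "heads xs < p"
    using * by (auto simp: heads_def intro: length_filter_less)
qed

text \<open>
  The residues of the \<open>p\<close> rotations form an arithmetic progression whose step is the number of
  heads, which is coprime to the prime \<open>p\<close>.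
\<close>
lemma ex1_rotation:
  assumes p: "prime p" and xs: "xs \<in> mixed_lists p" and m: "m < p"
  shows "\<exists>!s. s < p \<and> S_head (rotate s xs) mod p = m"
proof -
  let ?h = "heads xs"
  have len: "length xs = p" using xs by (simp add: mixed_lists_def)
  have cop: "coprime ?h p"
    using heads_mixed[OF xs] p
    by (metis coprime_commute nat_dvd_not_less prime_imp_coprime)
  have rot: "[S_head (rotate s xs) + s * ?h = S_head xs] (mod p)" for s
    using S_head_rotate[of s xs] len by simp
  have inj: "inj_on (\<lambda>s. S_head (rotate s xs) mod p) {..<p}"
  proof (rule inj_onI)
    fix s t assume st: "s \<in> {..<p}" "t \<in> {..<p}"
      "S_head (rotate s xs) mod p = S_head (rotate t xs) mod p"
    have "[S_head (rotate s xs) + t * ?h = S_head (rotate t xs) + t * ?h] (mod p)"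
      using st(3) by (intro cong_add) (simp_all add: cong_def)
    with rot[of s] rot[of t]
    have "[S_head (rotate s xs) + s * ?h = S_head (rotate s xs) + t * ?h] (mod p)"
      by (meson cong_sym cong_trans)
    then have "[s * ?h = t * ?h] (mod p)"
      by (simp add: cong_add_lcancel_nat)
    then have "[s = t] (mod p)"
      using cop by (simp add: cong_mult_rcancel_nat)
    then show "s = t" using st by (simp add: cong_def)
  qed
  have "(\<lambda>s. S_head (rotate s xs) mod p) ` {..<p} = {..<p}"
    using m by (intro endo_inj_surj inj) auto
  then have "m \<in> (\<lambda>s. S_head (rotate s xs) mod p) ` {..<p}" using m by simp
  then obtain s where "s < p" "S_head (rotate s xs) mod p = m" by auto
  then show ?thesis using inj by (auto simp: inj_on_def)
qed

lemma flip_weight_rotate [simp]: "flip_weight a (rotate s xs) = flip_weight a xs"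
proof -
  have "flip_weight a (rotate1 ys) = flip_weight a ys" for ys
    by (cases ys) (simp_all add: flip_weight_def mult.commute)
  then show ?thesis by (induction s) simp_all
qed

lemma bij_betw_rotate_mixed: "bij_betw (rotate s) (mixed_lists p) (mixed_lists p)"
proof -
  have "inj (rotate1 :: coin list \<Rightarrow> _)"
  proof (rule injI)
    fix xs ys :: "coin list" assume "rotate1 xs = rotate1 ys"
    then show "xs = ys" by (cases xs; cases ys) auto
  qed
  then have "inj (rotate s :: coin list \<Rightarrow> _)"
    by (simp add: rotate_def inj_fn)
  then have inj: "inj_on (rotate s) (mixed_lists p)" by (rule inj_on_subset) simp
  moreover have "rotate s ` mixed_lists p \<subseteq> mixed_lists p"
    by (auto simp: mixed_lists_def constant_block_def)
  ultimately show ?thesis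
    by (simp add: bij_betw_def endo_inj_surj finite_mixed_lists)
qed

text \<open>
  Double counting over pairs of a mixed list and a rotation: rotating permutes the mixed lists and
  preserves weights, while each mixed list meets the residue \<open>m\<close> in exactly one of its rotations.
\<close>
lemma sum_weight_residue:
  assumes p: "prime p" and m: "m < p"
  shows "real p * (\<Sum>xs | xs \<in> mixed_lists p \<and> S_head xs mod p = m. flip_weight a xs)
       = (\<Sum>xs\<in>mixed_lists p. flip_weight a xs)"
proof -
  let ?f = "\<lambda>xs. if S_head xs mod p = m then flip_weight a xs else 0"
  have "real p * (\<Sum>xs | xs \<in> mixed_lists p \<and> S_head xs mod p = m. flip_weight a xs)
      = (\<Sum>s<p. \<Sum>xs\<in>mixed_lists p. ?f xs)"
    by (simp add: sum.If_cases finite_mixed_lists Int_def)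
  also have "\<dots> = (\<Sum>s<p. \<Sum>xs\<in>mixed_lists p. ?f (rotate s xs))"
    by (intro sum.cong refl sum.reindex_bij_betw[symmetric] bij_betw_rotate_mixed)
  also have "\<dots> = (\<Sum>xs\<in>mixed_lists p. \<Sum>s<p. ?f (rotate s xs))"
    by (rule sum.swap)
  also have "\<dots> = (\<Sum>xs\<in>mixed_lists p. flip_weight a xs)"
  proof (rule sum.cong[OF refl])
    fix xs assume xs: "xs \<in> mixed_lists p"
    obtain s where s: "s < p" "S_head (rotate s xs) mod p = m"
      and uniq: "\<And>t. t < p \<Longrightarrow> S_head (rotate t xs) mod p = m \<longleftrightarrow> t = s"
      using ex1_rotation[OF p xs m] by blast
    have "(\<Sum>t<p. ?f (rotate t xs)) = (\<Sum>t<p. if t = s then flip_weight a xs else 0)"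
      by (intro sum.cong refl) (simp add: uniq)
    also have "\<dots> = flip_weight a xs" using s by simp
    finally show "(\<Sum>t<p. ?f (rotate t xs)) = flip_weight a xs" .
  qed
  finally show ?thesis .
qed

section \<open>Blocks of length two\<close>

lemma A2_step_two:
  "A2_from 2 x k =
     (case (x k, x (k + 1)) of
        (Heads, Heads) \<Rightarrow> A2_from 2 x (k + 2)
      | (Tails, Tails) \<Rightarrow> A2_from 2 x (k + 2)
      | (Heads, Tails) \<Rightarrow> Some (0, k + 2)
      | (Tails, Heads) \<Rightarrow> Some (1, k + 2))"
proof -
  have "[k..<k + 2] = [k, k + 1]" by (simp add: upt_rec)
  then show ?thesis
    by (subst A2_from.simps)
       (simp add: Let_def S_head_def numeral_2_eq_2 lessThan_Suc split: coin.split)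
qed

lemma A1_imp_A2:
  assumes "A1_from x k = Some y"
  shows "A2_from 2 x k = Some y"
  by (rule A1_from_induct[OF _ assms, where P = "\<lambda>x k y. A2_from 2 x k = Some y"])
     (subst A2_step_two, auto split: coin.splits)

lemma A2_imp_A1:
  assumes "A2_from 2 x k = Some y"
  shows "A1_from x k = Some y"
proof -
  \<comment> \<open>The induction rule varies the block length, so its value becomes a premise.\<close>
  have "2 = (2 :: nat) \<longrightarrow> A1_from x k = Some y"
  proof (rule A2_from_induct[OF _ assms, where P = "\<lambda>p x k y. p = 2 \<longrightarrow> A1_from x k = Some y"],
      intro impI)
    fix f and p :: nat and x :: "nat \<Rightarrow> coin" and k y
    assume IH: "\<And>p x k y. f p x k = Some y \<Longrightarrow> p = 2 \<longrightarrow> A1_from x k = Some y"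
      and run: "(let xs = map x [k..<k + p] in
        if (\<forall>c\<in>set xs. c = Heads) \<or> (\<forall>c\<in>set xs. c = Tails) then f p x (k + p)
        else Some (S_head xs mod p, k + p)) = Some y"
      and p: "p = 2"
    have "[k..<k + 2] = [k, k + 1]" by (simp add: upt_rec)
    then show "A1_from x k = Some y"
      using run IH[of 2] unfolding p
      by (subst A1_from.simps)
         (auto simp: Let_def S_head_def numeral_2_eq_2 lessThan_Suc split: coin.splits if_splits)
  qed
  then show ?thesis by simp
qed

lemma A2_two_eq_A1: "A2 2 x = A1 x"
  unfolding A2_def A1_def
  by (metis A1_imp_A2 A2_imp_A1 not_None_eq)

section \<open>Weights of lists of flips\<close>

definition constant_lists :: "nat \<Rightarrow> coin list set" where
  "constant_lists p = {xs. length xs = p \<and> constant_block xs}"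

lemma constant_lists_eq: "constant_lists p = {replicate p Heads, replicate p Tails}"
  by (auto simp: constant_lists_def constant_block_def replicate_length_same[symmetric])

lemma sum_weight_constant:
  assumes "0 < p"
  shows "(\<Sum>xs\<in>constant_lists p. flip_weight a xs) = a ^ p + (1 - a) ^ p"
proof -
  \<comment> \<open>The two constant lists coincide when they are empty, hence the assumption.\<close>
  have "replicate p Heads \<noteq> replicate p Tails" using assms by simp
  then show ?thesis
    by (simp add: constant_lists_eq flip_weight_def map_replicate prod_list_replicate)
qed

lemma flip_weight_append: "flip_weight a (xs @ ys) = flip_weight a xs * flip_weight a ys"
  by (simp add: flip_weight_def)

lemma sum_weight_append:
  assumes "C \<subseteq> {xs. length xs = s}"
  shows "(\<Sum>zs\<in>(\<lambda>(c, d). c @ d) ` (C \<times> A). flip_weight a zs)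
       = (\<Sum>c\<in>C. flip_weight a c) * (\<Sum>d\<in>A. flip_weight a d)"
proof -
  have "inj_on (\<lambda>(c, d). c @ d) (C \<times> A)"
    using assms by (auto simp: inj_on_def subset_iff)
  then have "(\<Sum>zs\<in>(\<lambda>(c, d). c @ d) ` (C \<times> A). flip_weight a zs)
      = (\<Sum>(c, d)\<in>C \<times> A. flip_weight a c * flip_weight a d)"
    by (simp add: sum.reindex case_prod_unfold flip_weight_append o_def)
  then show ?thesis by (simp add: sum_product sum.cartesian_product)
qed

text \<open>Both powers decrease in the exponent, so \<open>p = 2\<close> is the worst case.\<close>
lemma power_sum_le:
  fixes a :: real
  assumes "0 < a" "a < 1" "2 \<le> p"
  shows "a ^ p + (1 - a) ^ p \<le> 1 - 2 * a * (1 - a)"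
proof -
  have "a ^ p \<le> a ^ 2" "(1 - a) ^ p \<le> (1 - a) ^ 2"
    using assms by (auto intro!: power_decreasing)
  moreover have "a ^ 2 + (1 - a) ^ 2 = 1 - 2 * a * (1 - a)"
    by (simp add: power2_eq_square algebra_simps)
  ultimately show ?thesis by linarith
qed

section \<open>Independent biased flips\<close>

locale biased_flips = prob_space M for M :: "'w measure" +
  fixes X :: "nat \<Rightarrow> 'w \<Rightarrow> coin" and a :: real
  assumes bias: "0 < a" "a < 1"
    and indep: "indep_vars (\<lambda>_. count_space UNIV) X UNIV"
    and prob_Heads: "\<And>i. prob {\<omega> \<in> space M. X i \<omega> = Heads} = a"
    and prob_Tails: "\<And>i. prob {\<omega> \<in> space M. X i \<omega> = Tails} = 1 - a"
begin

definition flips :: "'w \<Rightarrow> nat \<Rightarrow> coin" where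
  "flips \<omega> = (\<lambda>i. X i \<omega>)"

lemma prob_constant_less_1:
  assumes "2 \<le> p"
  shows "a ^ p + (1 - a) ^ p < 1"
proof -
  have "0 < 2 * a * (1 - a)" using bias by simp
  then show ?thesis using power_sum_le[OF bias assms] by linarith
qed

lemma sets_flip: "{\<omega> \<in> space M. X i \<omega> = c} \<in> events"
proof -
  have "X i \<in> M \<rightarrow>\<^sub>M count_space UNIV"
    using indep by (simp add: indep_vars_def)
  then have "X i -` {c} \<inter> space M \<in> events" by (rule measurable_sets) simp
  then show ?thesis by (simp add: vimage_def Int_def conj_commute)
qed

lemma cylinder_eq:
  assumes "length ys = n"
  shows "{\<omega> \<in> space M. map (flips \<omega>) [0..<n] = ys} = {\<omega> \<in> space M. \<forall>i\<in>{..<n}. X i \<omega> = ys ! i}"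
  using assms by (auto simp: list_eq_iff_nth_eq flips_def)

lemma sets_cylinder:
  assumes "length ys = n"
  shows "{\<omega> \<in> space M. map (flips \<omega>) [0..<n] = ys} \<in> events"
  unfolding cylinder_eq[OF assms] by (intro sets.sets_Collect_finite_All sets_flip) simp

lemma prob_cylinder:
  assumes "length ys = n"
  shows "prob {\<omega> \<in> space M. map (flips \<omega>) [0..<n] = ys} = flip_weight a ys"
proof (cases "n = 0")
  case True
  then show ?thesis using assms by (simp add: flip_weight_def prob_space)
next
  case False
  have "{\<omega> \<in> space M. map (flips \<omega>) [0..<n] = ys} = (\<Inter>i\<in>{..<n}. X i -` {ys ! i} \<inter> space M)"
    unfolding cylinder_eq[OF assms] using False by auto
  also have "prob \<dots> = (\<Prod>i\<in>{..<n}. prob (X i -` {ys ! i} \<inter> space M))"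
    using False by (intro indep_varsD[OF indep]) auto
  also have "\<dots> = (\<Prod>i\<in>{..<n}. if ys ! i = Heads then a else 1 - a)"
  proof (rule prod.cong[OF refl])
    fix i
    have "X i -` {c} \<inter> space M = {\<omega> \<in> space M. X i \<omega> = c}" for c by auto
    then show "prob (X i -` {ys ! i} \<inter> space M) = (if ys ! i = Heads then a else 1 - a)"
      using prob_Heads[of i] prob_Tails[of i] by (cases "ys ! i") auto
  qed
  also have "\<dots> = flip_weight a ys"
    using assms by (simp add: flip_weight_def prod.list_conv_set_nth atLeast0LessThan)
  finally show ?thesis .
qed

lemma
  assumes "A \<subseteq> {xs. length xs = n}"
  shows sets_prefix: "{\<omega> \<in> space M. map (flips \<omega>) [0..<n] \<in> A} \<in> events"
    and prob_prefix: "prob {\<omega> \<in> space M. map (flips \<omega>) [0..<n] \<in> A} = (\<Sum>ys\<in>A. flip_weight a ys)"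
proof -
  have fin: "finite A" using assms finite_coin_lists finite_subset by blast
  have eq: "{\<omega> \<in> space M. map (flips \<omega>) [0..<n] \<in> A}
      = (\<Union>ys\<in>A. {\<omega> \<in> space M. map (flips \<omega>) [0..<n] = ys})"
    by auto
  show "{\<omega> \<in> space M. map (flips \<omega>) [0..<n] \<in> A} \<in> events"
    unfolding eq using fin assms by (intro sets.finite_UN sets_cylinder) auto
  have "prob (\<Union>ys\<in>A. {\<omega> \<in> space M. map (flips \<omega>) [0..<n] = ys})
      = (\<Sum>ys\<in>A. prob {\<omega> \<in> space M. map (flips \<omega>) [0..<n] = ys})"
    using fin assms
    by (intro finite_measure_finite_Union) (auto simp: disjoint_family_on_def intro!: sets_cylinder)
  also have "\<dots> = (\<Sum>ys\<in>A. flip_weight a ys)"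
    using assms by (intro sum.cong refl prob_cylinder) auto
  finally show "prob {\<omega> \<in> space M. map (flips \<omega>) [0..<n] \<in> A} = (\<Sum>ys\<in>A. flip_weight a ys)"
    unfolding eq .
qed

text \<open>Independence of consecutive stretches: cylinder weights are multiplicative under append.\<close>
lemma
  assumes C: "C \<subseteq> {xs. length xs = s}" and A: "A \<subseteq> {xs. length xs = n}"
  shows sets_append:
      "{\<omega> \<in> space M. map (flips \<omega>) [0..<s] \<in> C \<and> map (flips \<omega>) [s..<s + n] \<in> A} \<in> events"
    and prob_append:
      "prob {\<omega> \<in> space M. map (flips \<omega>) [0..<s] \<in> C \<and> map (flips \<omega>) [s..<s + n] \<in> A}
       = prob {\<omega> \<in> space M. map (flips \<omega>) [0..<s] \<in> C} * (\<Sum>ys\<in>A. flip_weight a ys)"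
proof -
  let ?CA = "(\<lambda>(c, d). c @ d) ` (C \<times> A)"
  have sub: "?CA \<subseteq> {xs. length xs = s + n}" using C A by (auto simp: subset_iff)
  have "map (flips \<omega>) [0..<s + n] \<in> ?CA \<longleftrightarrow>
      map (flips \<omega>) [0..<s] \<in> C \<and> map (flips \<omega>) [s..<s + n] \<in> A" for \<omega>
  proof -
    have *: "map (flips \<omega>) [0..<s + n] = map (flips \<omega>) [0..<s] @ map (flips \<omega>) [s..<s + n]"
      using upt_add_eq_append[of 0 s n] by simp
    have "map (flips \<omega>) [0..<s] = c \<and> map (flips \<omega>) [s..<s + n] = d"
      if "c \<in> C" "d \<in> A" "map (flips \<omega>) [0..<s + n] = c @ d" for c d
      using that C unfolding * by (subst (asm) append_eq_append_conv) (auto simp: subset_iff)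
    then show ?thesis using * by fastforce
  qed
  then have eq: "{\<omega> \<in> space M. map (flips \<omega>) [0..<s] \<in> C \<and> map (flips \<omega>) [s..<s + n] \<in> A}
      = {\<omega> \<in> space M. map (flips \<omega>) [0..<s + n] \<in> ?CA}"
    by auto
  show "{\<omega> \<in> space M. map (flips \<omega>) [0..<s] \<in> C \<and> map (flips \<omega>) [s..<s + n] \<in> A} \<in> events"
    unfolding eq by (rule sets_prefix[OF sub])
  show "prob {\<omega> \<in> space M. map (flips \<omega>) [0..<s] \<in> C \<and> map (flips \<omega>) [s..<s + n] \<in> A}
       = prob {\<omega> \<in> space M. map (flips \<omega>) [0..<s] \<in> C} * (\<Sum>ys\<in>A. flip_weight a ys)"
    unfolding eq prob_prefix[OF sub] prob_prefix[OF C] by (rule sum_weight_append[OF C])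
qed

text \<open>The event that the first \<open>j\<close> blocks do not end the run, so that block \<open>j\<close> is read.\<close>
definition waiting :: "nat \<Rightarrow> nat \<Rightarrow> 'w set" where
  "waiting p j = {\<omega> \<in> space M. \<forall>l<j. constant_block (block p (flips \<omega>) l)}"

text \<open>This puts the event into a form that visibly depends on the first \<open>j * p\<close> flips only.\<close>
lemma waiting_eq_prefix:
  "waiting p j = {\<omega> \<in> space M. map (flips \<omega>) [0..<j * p] \<in>
     {xs. length xs = j * p \<and> (\<forall>l<j. constant_block (block p ((!) xs) l))}}"
proof -
  have "block p ((!) (map x [0..<j * p])) l = block p x l" if "l < j" for l and x :: "nat \<Rightarrow> coin"
  proof -
    have "Suc l * p \<le> j * p" using that by (intro mult_right_mono) auto
    then show ?thesis by (auto simp: block_def)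
  qed
  then show ?thesis by (auto simp: waiting_def)
qed

lemma sets_waiting: "waiting p j \<in> events"
  unfolding waiting_eq_prefix by (rule sets_prefix) auto

lemma
  assumes A: "A \<subseteq> {xs. length xs = p}"
  shows sets_waiting_block: "{\<omega> \<in> waiting p j. block p (flips \<omega>) j \<in> A} \<in> events"
    and prob_waiting_block: "prob {\<omega> \<in> waiting p j. block p (flips \<omega>) j \<in> A}
       = prob (waiting p j) * (\<Sum>ys\<in>A. flip_weight a ys)"
proof -
  let ?C = "{xs. length xs = j * p \<and> (\<forall>l<j. constant_block (block p ((!) xs) l))}"
  have C: "?C \<subseteq> {xs. length xs = j * p}" by auto
  have eq: "{\<omega> \<in> waiting p j. block p (flips \<omega>) j \<in> A} =
      {\<omega> \<in> space M. map (flips \<omega>) [0..<j * p] \<in> ?C \<and> map (flips \<omega>) [j * p..<j * p + p] \<in> A}"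
    unfolding waiting_eq_prefix by (auto simp: block_def)
  show "{\<omega> \<in> waiting p j. block p (flips \<omega>) j \<in> A} \<in> events"
    unfolding eq by (rule sets_append[OF C A])
  show "prob {\<omega> \<in> waiting p j. block p (flips \<omega>) j \<in> A}
       = prob (waiting p j) * (\<Sum>ys\<in>A. flip_weight a ys)"
    unfolding eq prob_append[OF C A] by (simp add: waiting_eq_prefix)
qed

text \<open>Each further constant block costs one independent factor.\<close>
lemma prob_waiting:
  assumes "0 < p"
  shows "prob (waiting p j) = (a ^ p + (1 - a) ^ p) ^ j"
proof (induction j)
  case 0
  then show ?case by (simp add: waiting_def prob_space)
next
  case (Suc j)
  have "waiting p (Suc j) = {\<omega> \<in> waiting p j. block p (flips \<omega>) j \<in> constant_lists p}"
    by (auto simp: waiting_def constant_lists_def less_Suc_eq)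
  also have "prob \<dots> = prob (waiting p j) * (a ^ p + (1 - a) ^ p)"
    using assms by (subst prob_waiting_block) (auto simp: constant_lists_def[of p] sum_weight_constant[symmetric])
  finally show ?case using Suc by simp
qed

text \<open>The weights of all lists of length \<open>p\<close> sum to \<open>1\<close>, the probability of the sure event.\<close>
lemma sum_weight_mixed:
  assumes "0 < p"
  shows "(\<Sum>xs\<in>mixed_lists p. flip_weight a xs) = 1 - (a ^ p + (1 - a) ^ p)"
proof -
  have "(\<Sum>xs | length xs = p. flip_weight a xs) = 1"
    using prob_prefix[of "{xs. length xs = p}" p] by (simp add: prob_space)
  moreover have "{xs. length xs = p} = mixed_lists p \<union> constant_lists p"
    by (auto simp: mixed_lists_def constant_lists_def)
  moreover have "mixed_lists p \<inter> constant_lists p = {}"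
    by (auto simp: mixed_lists_def constant_lists_def)
  moreover have "finite (constant_lists p)" by (simp add: constant_lists_eq)
  ultimately have "(\<Sum>xs\<in>mixed_lists p. flip_weight a xs) + (\<Sum>xs\<in>constant_lists p. flip_weight a xs) = 1"
    using finite_mixed_lists[of p] by (simp add: sum.union_disjoint)
  then show ?thesis using sum_weight_constant[OF assms, of a] by simp
qed

text \<open>
  Results of runs form a countable type, so singletons suffice; a given result depends on finitely
  many flips, and divergence is a countable intersection of such events.
\<close>
lemma measurable_A2: "(\<lambda>\<omega>. A2 p (flips \<omega>)) \<in> M \<rightarrow>\<^sub>M count_space UNIV"
proof -
  have "(\<lambda>\<omega>. A2 p (flips \<omega>)) -` {y} \<inter> space M \<in> events" for y
  proof (cases y)
    case None
    have "(\<lambda>\<omega>. A2 p (flips \<omega>)) -` {y} \<inter> space M = (\<Inter>j. waiting p j)"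
      by (auto simp: None A2_eq_None_iff waiting_def) (use lessI in blast)
    then show ?thesis using sets_waiting by auto
  next
    case (Some z)
    obtain r n where z: "z = (r, n)" by force
    have "(\<lambda>\<omega>. A2 p (flips \<omega>)) -` {y} \<inter> space M =
        (\<Union>j\<in>{j. n = Suc j * p}. {\<omega> \<in> waiting p j. block p (flips \<omega>) j
            \<in> {xs \<in> mixed_lists p. S_head xs mod p = r}})"
      by (auto simp: Some z A2_eq_Some_iff waiting_def mixed_lists_def)
    also have "\<dots> \<in> events"
    proof (rule sets.countable_UN')
      have "{\<omega> \<in> waiting p j. block p (flips \<omega>) j
          \<in> {xs \<in> mixed_lists p. S_head xs mod p = r}} \<in> events" for j
        by (rule sets_waiting_block) (auto simp: mixed_lists_def)
      then show "(\<lambda>j. {\<omega> \<in> waiting p j. block p (flips \<omega>) j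
          \<in> {xs \<in> mixed_lists p. S_head xs mod p = r}}) ` {j. n = Suc j * p} \<subseteq> events"
        by blast
    qed auto
    finally show ?thesis .
  qed
  then show ?thesis by (subst measurable_count_space_eq2_countable) auto
qed

lemma nn_integral_flips_used:
  assumes "2 \<le> p"
  shows "(\<integral>\<^sup>+ \<omega>. flips_used (A2 p (flips \<omega>)) \<partial>M) = ennreal (real p / (1 - a ^ p - (1 - a) ^ p))"
proof -
  let ?q = "a ^ p + (1 - a) ^ p"
  have p: "0 < p" and lt: "?q < 1" and q: "0 \<le> ?q"
    using assms prob_constant_less_1 bias by auto
  have "(\<integral>\<^sup>+ \<omega>. flips_used (A2 p (flips \<omega>)) \<partial>M)
      = (\<integral>\<^sup>+ \<omega>. (\<Sum>j. ennreal (real p) * indicator (waiting p j) \<omega>) \<partial>M)"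
    by (intro nn_integral_cong) (simp add: flips_used_A2[OF p] waiting_def indicator_def)
  also have "\<dots> = (\<Sum>j. \<integral>\<^sup>+ \<omega>. ennreal (real p) * indicator (waiting p j) \<omega> \<partial>M)"
    using sets_waiting by (intro nn_integral_suminf) auto
  also have "\<dots> = (\<Sum>j. ennreal (real p * ?q ^ j))"
    using sets_waiting q
    by (intro suminf_cong) (simp add: nn_integral_cmult_indicator emeasure_eq_measure prob_waiting[OF p] ennreal_mult)
  also have "\<dots> = ennreal (real p * (1 / (1 - ?q)))"
    using q lt by (intro suminf_ennreal_eq sums_mult geometric_sums) auto
  finally show ?thesis by (simp add: algebra_simps)
qed

text \<open>A diverging run uses infinitely many flips, which a finite expectation forbids.\<close>
lemma prob_terminates:
  assumes "2 \<le> p"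
  shows "prob {\<omega> \<in> space M. terminates (A2 p (flips \<omega>))} = 1"
proof -
  have "(\<lambda>\<omega>. flips_used (A2 p (flips \<omega>))) \<in> borel_measurable M"
    by (rule measurable_compose[OF measurable_A2]) simp
  moreover have "(\<integral>\<^sup>+ \<omega>. flips_used (A2 p (flips \<omega>)) \<partial>M) \<noteq> \<infinity>"
    using nn_integral_flips_used[OF assms] by simp
  ultimately have "AE \<omega> in M. flips_used (A2 p (flips \<omega>)) \<noteq> \<infinity>"
    by (rule nn_integral_PInf_AE)
  then have *: "AE \<omega> in M. terminates (A2 p (flips \<omega>))"
    by eventually_elim (auto simp: terminates_def flips_used_def split: option.splits)
  have "{\<omega> \<in> space M. terminates (A2 p (flips \<omega>))} \<in> events"
    using measurable_sets[OF measurable_A2, of "{y. terminates y}" p]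
    by (simp add: vimage_def Int_def conj_commute)
  then show ?thesis using * by (simp add: prob_Collect_eq_1)
qed

text \<open>Sum over the block \<open>j\<close> at which the run stops; the residue law of that block is uniform.\<close>
lemma prob_return_value:
  assumes p: "prime p" and m: "m < p"
  shows "prob {\<omega> \<in> space M. return_value (A2 p (flips \<omega>)) = Some m} = 1 / real p"
proof -
  let ?q = "a ^ p + (1 - a) ^ p"
  let ?A = "{xs. xs \<in> mixed_lists p \<and> S_head xs mod p = m}"
  let ?E = "\<lambda>j. {\<omega> \<in> waiting p j. block p (flips \<omega>) j \<in> ?A}"
  have p0: "0 < p" using p by (rule prime_gt_0_nat)
  have q: "0 \<le> ?q" using bias by simp
  have lt: "?q < 1" using prob_constant_less_1 prime_ge_2_nat[OF p] by blast
  have A: "?A \<subseteq> {xs. length xs = p}" by (auto simp: mixed_lists_def)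
  have W: "(\<Sum>xs\<in>?A. flip_weight a xs) = (1 - ?q) / real p"
    using sum_weight_residue[OF p m, of a] sum_weight_mixed[OF p0] p0 by (simp add: field_simps)
  have E: "prob (?E j) = (1 - ?q) / real p * ?q ^ j" for j
    unfolding prob_waiting_block[OF A] prob_waiting[OF p0] W by simp
  have "(\<lambda>j. prob (?E j)) sums prob (\<Union>j. ?E j)"
  proof (rule finite_measure_UNION)
    show "range ?E \<subseteq> events" using sets_waiting_block[OF A] by blast
    have disj: "?E i \<inter> ?E j = {}" if "i < j" for i j
      using that by (auto simp: waiting_def mixed_lists_def)
    show "disjoint_family ?E"
      unfolding disjoint_family_on_def
    proof (intro ballI impI)
      fix i j :: nat assume "i \<noteq> j"
      then consider "i < j" | "j < i" by linarith
      then show "?E i \<inter> ?E j = {}"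
        using disj[of i j] disj[of j i] by cases (simp, simp only: Int_commute)
    qed
  qed
  moreover have "(\<lambda>j. prob (?E j)) sums ((1 - ?q) / real p * (1 / (1 - ?q)))"
    unfolding E using q lt by (intro sums_mult geometric_sums) simp
  ultimately have "prob (\<Union>j. ?E j) = (1 - ?q) / real p * (1 / (1 - ?q))"
    by (rule sums_unique2)
  moreover have "{\<omega> \<in> space M. return_value (A2 p (flips \<omega>)) = Some m} = (\<Union>j. ?E j)"
    by (auto simp: return_value_def A2_eq_Some_iff waiting_def mixed_lists_def)
  ultimately show ?thesis using lt by simp
qed

end

theorem theorem4p1:
  fixes M :: "'w measure" and X :: "nat \<Rightarrow> 'w \<Rightarrow> coin" and a b :: real
  assumes "0 < a" "a < 1" "b = 1 - a"
    and "prob_space M"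
    and "prob_space.indep_vars M (\<lambda>_. count_space UNIV) X UNIV"
    and "\<And>i. measure M {\<omega> \<in> space M. X i \<omega> = Heads} = a"
    and "\<And>i. measure M {\<omega> \<in> space M. X i \<omega> = Tails} = b"
  shows
    "(\<forall>p. prime p \<longrightarrow>
        (\<lambda>\<omega>. A2 p (\<lambda>i. X i \<omega>)) \<in> M \<rightarrow>\<^sub>M count_space UNIV \<and>
        measure M {\<omega> \<in> space M. terminates (A2 p (\<lambda>i. X i \<omega>))} = 1 \<and>
        (\<forall>m\<in>{0..p - 1}.
           measure M {\<omega> \<in> space M. return_value (A2 p (\<lambda>i. X i \<omega>)) = Some m} = 1 / real p) \<and>
        (\<integral>\<^sup>+ \<omega>. flips_used (A2 p (\<lambda>i. X i \<omega>)) \<partial>M) = ennreal (real p / (1 - a ^ p - b ^ p))) \<and>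
     (\<lambda>p. enn2real (\<integral>\<^sup>+ \<omega>. flips_used (A2 p (\<lambda>i. X i \<omega>)) \<partial>M))
        \<in> O[inf at_top (principal {p. prime p})](\<lambda>p. real p) \<and>
     (\<forall>x. A2 2 x = A1 x)"
proof -
  interpret prob_space M by (rule assms(4))
  interpret biased_flips M X a
    by unfold_locales (use assms in auto)
  have flips: "(\<lambda>i. X i \<omega>) = flips \<omega>" for \<omega> by (simp add: flips_def)
  have ab: "0 < 2 * a * (1 - a)" using assms by simp
  have I: "(\<integral>\<^sup>+ \<omega>. flips_used (A2 p (flips \<omega>)) \<partial>M) = ennreal (real p / (1 - a ^ p - b ^ p))"
    if "prime p" for p
    using nn_integral_flips_used[OF prime_ge_2_nat[OF that]] assms(3) by simp
  have O: "(\<lambda>p. enn2real (\<integral>\<^sup>+ \<omega>. flips_used (A2 p (flips \<omega>)) \<partial>M))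
      \<in> O[inf at_top (principal {p. prime p})](\<lambda>p. real p)"
  proof (rule bigoI)
    show "\<forall>\<^sub>F p in inf at_top (principal {p. prime p}).
        norm (enn2real (\<integral>\<^sup>+ \<omega>. flips_used (A2 p (flips \<omega>)) \<partial>M))
          \<le> 1 / (2 * a * (1 - a)) * norm (real p)"
    proof (subst eventually_inf_principal, rule always_eventually, safe)
      fix p :: nat assume p: "prime p"
      have "2 * a * (1 - a) \<le> 1 - a ^ p - b ^ p"
        using power_sum_le[OF assms(1,2) prime_ge_2_nat[OF p]] assms(3) by simp
      moreover from this ab have pos: "0 < 1 - a ^ p - b ^ p" by linarith
      ultimately have "real p / (1 - a ^ p - b ^ p) \<le> real p / (2 * a * (1 - a))"
        "0 \<le> real p / (1 - a ^ p - b ^ p)"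
        using ab
        by (auto intro!: frac_le divide_nonneg_pos)
      then show "norm (enn2real (\<integral>\<^sup>+ \<omega>. flips_used (A2 p (flips \<omega>)) \<partial>M))
          \<le> 1 / (2 * a * (1 - a)) * norm (real p)"
        using pos by (simp add: I[OF p])
    qed
  qed
  show ?thesis
    unfolding flips
  proof (intro conjI allI impI ballI)
    fix p :: nat assume p: "prime p"
    show "(\<lambda>\<omega>. A2 p (flips \<omega>)) \<in> M \<rightarrow>\<^sub>M count_space UNIV"
      by (rule measurable_A2)
    show "prob {\<omega> \<in> space M. terminates (A2 p (flips \<omega>))} = 1"
      using prob_terminates[OF prime_ge_2_nat[OF p]] .
    show "prob {\<omega> \<in> space M. return_value (A2 p (flips \<omega>)) = Some m} = 1 / real p"
      if "m \<in> {0..p - 1}" for m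
      using prob_return_value[OF p] that prime_gt_0_nat[OF p] by auto
    show "(\<integral>\<^sup>+ \<omega>. flips_used (A2 p (flips \<omega>)) \<partial>M) = ennreal (real p / (1 - a ^ p - b ^ p))"
      by (rule I[OF p])
  next
    show "A2 2 x = A1 x" for x by (rule A2_two_eq_A1)
  qed (rule O)
qed

end
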